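(* Let $p,k\in\mathbb N$ and let $T\subset\mathbb R^d$ be an `infinite' element with base $F$ of the form $$T=\{\mathbf x=\mathbf x_F+t\mathbf b_F:\ \mathbf x_F\in F,\ t\in(0,\infty)\},\qquad\mathbf b_F\in\mathbb R^d.$$ Then, for every polynomial $v\in\mathcal P_p(T)$ of degree at most $p$, $$\int_Fv^2(\mathbf s)\,\mathrm e^{-|\mathbf s|^{2k}/(2k)}\,\mathrm d\mathbf s\le\tilde c_{\rm inv}(k,\delta_T)\,p^{2-1/(2k)}\int_Tv^2(\mathbf x)\,\mathrm e^{-|\mathbf x|^{2k}/(2k)}\,\mathrm d\mathbf x,$$ with $$\tilde c_{\rm inv}(k,\delta_T):=\frac{\big((p^{1/(2k)}+\delta_T)^{2k}+2p+6\big)^2}{4p^2\min_\theta\sin\theta},$$ where $\theta$ denotes the angles of $T$.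
   Context: $F$ is a $(d-1)$-dimensional base lying in a hyperplane transversal to $\mathbf b_F$. $\delta_T:=\sup\{|\mathbf x|:\mathbf x\in F\}$. The angles $\theta$ of $T$ are understood to include the angle between the axis $\mathbf b_F$ and the hyperplane of $F$; so $|\hat F|/|F|\ge\min_\theta\sin\theta$, where $\hat F$ is the base of the right-angle prism with axis $\mathbf b_F$ related to $T$ by a shear transformation and $|\cdot|$ is $(d-1)$-dimensional volume. *)

theory Defs
  imports "HOL-Analysis.Analysis"
begin

text \<open>Lebesgue measure of dimension \<open>aff_dim A\<close> on a nonempty affine subspace \<open>A\<close>, as a measure
  on the ambient Borel sets. As in the library definition of \<^const>\<open>lborel\<close>, it is the image of a
  product of one-dimensional Lebesgue measures, here with respect to an orthonormal basis of the
  direction space of \<open>A\<close>. The measure does not depend on the chosen base point and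
  orthonormal basis, since Lebesgue measure is invariant under translations and orthogonal maps.\<close>

definition orthonormal_basis_of :: "'a::euclidean_space set \<Rightarrow> 'a set \<Rightarrow> bool" where
  "orthonormal_basis_of V B \<longleftrightarrow>
     pairwise orthogonal B \<and> (\<forall>e\<in>B. norm e = 1) \<and> span B = V"

definition affine_lborel :: "'a::euclidean_space set \<Rightarrow> 'a measure" where
  "affine_lborel A =
     (let a = (SOME a. a \<in> A);
          B = (SOME B. orthonormal_basis_of {x - a |x. x \<in> A} B)
      in distr (\<Pi>\<^sub>M e\<in>B. (lborel :: real measure)) borel (\<lambda>f. a + (\<Sum>e\<in>B. f e *\<^sub>R e)))"

text \<open>Polynomials in the Cartesian coordinates of total degree at most \<open>p\<close>, as functions on the
  whole space, so that they can be evaluated both on an element and on its base.\<close>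

definition multi_indices :: "nat \<Rightarrow> ('a::euclidean_space \<Rightarrow> nat) set" where
  "multi_indices p = {\<alpha> \<in> Basis \<rightarrow>\<^sub>E {..p}. (\<Sum>i\<in>Basis. \<alpha> i) \<le> p}"

definition polynomials_deg_le :: "nat \<Rightarrow> ('a::euclidean_space \<Rightarrow> real) set" where
  "polynomials_deg_le p =
     {v. \<exists>c. \<forall>x. v x = (\<Sum>\<alpha>\<in>multi_indices p. c \<alpha> * (\<Prod>i\<in>Basis. (x \<bullet> i) ^ \<alpha> i))}"

definition infinite_element :: "'a::euclidean_space set \<Rightarrow> 'a \<Rightarrow> 'a set" where
  "infinite_element F b = {x + t *\<^sub>R b |x t. x \<in> F \<and> t > 0}"

text \<open>The angle in \<open>[0, \<pi>/2]\<close> between the line spanned by \<open>b\<close> and a hyperplane with normal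
  vector \<open>n\<close> (neither \<open>n\<close> nor \<open>b\<close> need be normalised).\<close>

definition axis_angle :: "'a::euclidean_space \<Rightarrow> 'a \<Rightarrow> real" where
  "axis_angle n b = arcsin (\<bar>n \<bullet> b\<bar> / (norm n * norm b))"

definition radius_of_base :: "'a::euclidean_space set \<Rightarrow> real" where
  "radius_of_base F = (SUP x\<in>F. norm x)"

text \<open>The set \<open>\<Theta>\<close> consists of the angles of the element. The base may have any shape, so apart from
  the angle between axis and base hyperplane there is no canonical list of angles; results are to
  be stated for every finite \<open>\<Theta> \<subseteq> (0, \<pi>)\<close> that contains this angle. The constant also depends
  on the degree \<open>p\<close>, which the customary notation suppresses.\<close>

definition c_inv :: "nat \<Rightarrow> nat \<Rightarrow> real \<Rightarrow> real set \<Rightarrow> real" where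
  "c_inv p k \<delta> \<Theta> =
     ((real p powr (1 / (2 * real k)) + \<delta>) ^ (2 * k) + 2 * real p + 6)\<^sup>2
       / (4 * (real p)\<^sup>2 * Min (sin ` \<Theta>))"

definition exp_weight :: "nat \<Rightarrow> 'a::euclidean_space \<Rightarrow> real" where
  "exp_weight k x = exp (- (norm x ^ (2 * k) / (2 * real k)))"

end

theory Submission
  imports Defs "HOL-Probability.Distributions"
begin

text \<open>By Fubini's theorem in the coordinates \<open>x = s + t b\<close> with \<open>b\<close> normalised, the claim
  reduces to rays: the Jacobian is the sine of the angle between axis and base, which is at least
  \<open>min sin \<theta>\<close>. On a ray put \<open>h = p powr (1 / (2 k))\<close> and \<open>M = h + \<delta>\<close>. Since \<open>\<bar>s + t b\<bar> ^ (2 k)\<close> is convex in \<open>t\<close>, on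
  \<open>0 \<le> t \<le> h\<close> the weight is at least its value at \<open>t = 0\<close> times \<open>exp (- D t / h)\<close>, where
  \<open>D = M ^ (2 k) / (2 k)\<close>, and this exponential dominates \<open>(1 - t / h) ^ (2 m)\<close> as soon as \<open>2 m \<ge> D\<close>. The
  unweighted inequality \<open>u(0)\<^sup>2 \<le> (N + 1)\<^sup>2 / h * \<integral> u\<^sup>2\<close> for polynomials of degree
  \<open>N = p + m\<close> on \<open>(0, h)\<close> then gives the result, because \<open>p + m + 1 \<le> (M ^ (2 k) + 2 p + 6) / 2\<close>.\<close>

subsection \<open>Trace inequality for polynomials on the unit interval\<close>

text \<open>The coefficients are the residues in the partial fraction expansion of
  \<open>K (x - 2) \<dots> (x - N - 1) / (x (x + 1) \<dots> (x + N))\<close>, which vanishes at \<open>x = 2, \<dots>, N + 1\<close>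
  and is normalised to have value \<open>1\<close> at \<open>x = 1\<close>.\<close>

lemma ex_cauchy_system_solution:
  "\<exists>r::nat \<Rightarrow> real. r 0 = (real N + 1)\<^sup>2 \<and>
     (\<forall>j\<le>N. (\<Sum>i\<le>N. r i / real (i + j + 1)) = (if j = 0 then 1 else 0))"
proof -
  \<comment> \<open>The factor \<open>(-1) ^ N * (real N + 1)\<close> is the normalisation: it makes
    the numerator at 1 equal to (N + 1)!, which is also the value of x (x + 1) ... (x + N)
    there.\<close>
  define G :: "real poly" where
    "G = smult ((-1) ^ N * (real N + 1)) (\<Prod>l=2..N+1. [:- real l, 1:])"
  define P where "P i = (\<Prod>l\<in>{..N}-{i}. [:real l, 1:])" for i
  define r where "r i = poly G (- real i) / poly (P i) (- real i)" for i
  define Q where "Q = (\<Sum>i\<le>N. smult (r i) (P i))"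
  have prod_neg: "(\<Prod>l\<in>S. c - real l) = (-1) ^ card S * (\<Prod>l\<in>S. real l - c)" for c S
    by (simp flip: prod_constant prod.distrib)
  have G_eq: "poly G c = (real N + 1) * (\<Prod>l=2..N+1. real l - c)" for c
    using prod_neg[of c "{2..N+1}"]
    by (simp add: G_def poly_prod del: prod.cl_ivl_Suc flip: power_mult_distrib)
  have P_nz: "poly (P i) (- real i) \<noteq> 0" for i
    by (auto simp: P_def poly_prod)
  have P_z: "poly (P i) (- real j) = 0" if "j \<le> N" "i \<noteq> j" for i j
    using that by (auto simp: P_def poly_prod)
  have degG: "degree G \<le> N"
  proof -
    have "degree G \<le> degree (\<Prod>l=2..N+1. [:- real l, 1:])"
      unfolding G_def by (rule degree_smult_le)
    also have "\<dots> \<le> sum (degree \<circ> (\<lambda>l. [:- real l, 1:])) {2..N+1}"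
      by (rule degree_prod_sum_le) simp
    finally show ?thesis by simp
  qed
  have degP: "degree (P i) \<le> N" if "i \<le> N" for i
  proof -
    have "degree (P i) \<le> sum (degree \<circ> (\<lambda>l. [:real l, 1:])) ({..N}-{i})"
      unfolding P_def by (rule degree_prod_sum_le) simp
    then show ?thesis using that by simp
  qed
  have degQ: "degree Q \<le> N"
    unfolding Q_def by (rule degree_sum_le) (auto intro: order.trans[OF degree_smult_le] degP)
  have card: "card ((\<lambda>i. - real i) ` {..N}) = N + 1"
    by (subst card_image) (auto simp: inj_on_def)
  \<comment> \<open>The partial fraction identity with denominators cleared: both sides have degree
    at most \<open>N\<close> and agree at the \<open>N + 1\<close> poles 0, -1, ..., -N.\<close>
  have "Q = G"
  proof (rule poly_eqI_degree)
    fix x assume "x \<in> (\<lambda>i. - real i) ` {..N}"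
    then obtain j where j: "j \<le> N" "x = - real j" by auto
    have "poly Q x = (\<Sum>i\<le>N. r i * poly (P i) (- real j))"
      by (simp add: Q_def poly_sum j)
    also have "\<dots> = (\<Sum>i\<in>{j}. r i * poly (P i) (- real j))"
      by (rule sum.mono_neutral_right) (use j P_z in auto)
    also have "\<dots> = poly G x" using P_nz[of j] by (simp add: r_def j)
    finally show "poly Q x = poly G x" .
  qed (use card degQ degG in simp_all)
  have frac: "(\<Sum>i\<le>N. r i / (x + real i)) = poly G x / (\<Prod>l\<le>N. x + real l)" if "x > 0" for x
  proof -
    have nz: "x + real l \<noteq> 0" for l using that by (smt (verit) of_nat_0_le_iff)
    have "r i / (x + real i) = r i * poly (P i) x / (\<Prod>l\<le>N. x + real l)" if "i \<le> N" for i
    proof -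
      have "(\<Prod>l\<le>N. x + real l) = (x + real i) * poly (P i) x"
        using that by (subst prod.remove[of _ i]) (auto simp: P_def poly_prod add.commute)
      moreover have "poly (P i) x \<noteq> 0" using nz by (auto simp: P_def poly_prod add.commute)
      ultimately show ?thesis using nz[of i] by simp
    qed
    then have "(\<Sum>i\<le>N. r i / (x + real i)) = poly Q x / (\<Prod>l\<le>N. x + real l)"
      by (simp add: Q_def poly_sum sum_divide_distrib)
    then show ?thesis by (simp add: \<open>Q = G\<close>)
  qed
  have prod_Suc: "(\<Prod>l=1..n. real l) = fact n" for n
    by (simp add: fact_prod)
  have shift: "(\<Prod>l=2..N+1. real l - 1) = fact N"
  proof -
    have "(\<Prod>l=2..N+1. real l - 1) = (\<Prod>l=1..N. real l)"
      using prod.shift_bounds_cl_Suc_ivl[of "\<lambda>l. real l - 1" 1 N]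
      by (simp add: numeral_2_eq_2 del: prod.cl_ivl_Suc)
    then show ?thesis by (simp only: prod_Suc)
  qed
  \<comment> \<open>The residue at 0 is (N + 1) (N + 1)! / N!.\<close>
  have r0: "r 0 = (real N + 1)\<^sup>2"
  proof -
    have "poly (P 0) 0 = (\<Prod>l=1..N. real l)"
      by (auto simp: P_def poly_prod intro!: prod.cong)
    moreover have "(\<Prod>l=2..N+1. real l) = fact (N + 1)"
      using prod_Suc[of "N+1"] prod.atLeast_Suc_atMost[of 1 "N+1" real]
      by (simp add: numeral_2_eq_2 del: prod.cl_ivl_Suc)
    moreover have "poly G 0 = (real N + 1) * (\<Prod>l=2..N+1. real l)"
      using G_eq[of 0] by simp
    ultimately show ?thesis
      by (simp add: r_def prod_Suc[unfolded One_nat_def] power2_eq_square add.commute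
          del: prod.cl_ivl_Suc)
  qed
  \<comment> \<open>Put x = j + 1 in \<open>frac\<close>: for \<open>j = 0\<close> this is the
    normalisation, for 1 \<le> j \<le> N it is a root of \<open>G\<close>.\<close>
  have "(\<Sum>i\<le>N. r i / real (i + j + 1)) = (if j = 0 then 1 else 0)" if "j \<le> N" for j
  proof -
    have eq: "(\<Sum>i\<le>N. r i / real (i + j + 1)) = poly G (real j + 1) / (\<Prod>l\<le>N. real j + 1 + real l)"
      using frac[of "real j + 1"] by (simp add: add_ac)
    show ?thesis
    proof (cases "j = 0")
      case True
      have "(\<Prod>l\<le>N. 1 + real l) = fact (N + 1)"
        using prod.shift_bounds_cl_Suc_ivl[of real 0 N] prod_Suc[of "N+1"]
        by (simp add: atMost_atLeast0 add.commute)
      then show ?thesis using True shift unfolding eq G_eq by (simp add: add.commute)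
    next
      case False
      have "\<exists>l\<in>{2..N+1}. real l - (real j + 1) = 0"
        by (rule bexI[of _ "j + 1"]) (use False that in auto)
      then have "(\<Prod>l=2..N+1. real l - (real j + 1)) = 0"
        by (intro prod_zero) auto
      then show ?thesis using False unfolding eq G_eq by simp
    qed
  qed
  with r0 show ?thesis by blast
qed

lemma has_integral_power_unit: "((\<lambda>t::real. t ^ n) has_integral 1 / real (n + 1)) {0..1}"
proof -
  have "((\<lambda>t::real. t ^ n) has_integral (1 ^ Suc n / real (Suc n) - 0 ^ Suc n / real (Suc n))) {0..1}"
    by (rule fundamental_theorem_of_calculus)
       (auto intro!: derivative_eq_intros simp del: power_Suc of_nat_Suc
             simp flip: has_real_derivative_iff_has_vector_derivative)
  then show ?thesis by (simp add: add.commute)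
qed

text \<open>Pairing a polynomial with coefficients \<open>c\<close> with t^j on the unit interval
  gives row \<open>j\<close> of the Cauchy system (here a Hilbert matrix), so its solution
  represents evaluation at 0 on polynomials of degree at most \<open>N\<close>.\<close>

lemma ex_reproducing_poly_unit:
  "\<exists>r::real poly. degree r \<le> N \<and> poly r 0 = (real N + 1)\<^sup>2 \<and>
     (\<forall>u. degree u \<le> N \<longrightarrow> integral {0..1} (\<lambda>t. poly r t * poly u t) = poly u 0)"
proof -
  obtain c :: "nat \<Rightarrow> real" where c0: "c 0 = (real N + 1)\<^sup>2" and
    c: "\<And>j. j \<le> N \<Longrightarrow> (\<Sum>i\<le>N. c i / real (i + j + 1)) = (if j = 0 then 1 else 0)"
    using ex_cauchy_system_solution by blast
  define r where "r = (\<Sum>i\<le>N. monom (c i) i)"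
  have poly_r: "poly r t = (\<Sum>i\<le>N. c i * t ^ i)" for t
    by (simp add: r_def poly_sum poly_monom)
  have "degree r \<le> N"
    unfolding r_def by (rule degree_sum_le) (auto intro: order.trans[OF degree_monom_le])
  moreover have "poly r 0 = (real N + 1)\<^sup>2"
    by (simp add: r_def poly_0_coeff_0 coeff_sum c0)
  moreover have "integral {0..1} (\<lambda>t. poly r t * poly u t) = poly u 0" if u: "degree u \<le> N" for u
  proof (rule integral_unique)
    have "((\<lambda>t. \<Sum>j\<le>N. \<Sum>i\<le>N. coeff u j * (c i * t ^ (i + j))) has_integral
        (\<Sum>j\<le>N. \<Sum>i\<le>N. coeff u j * (c i * (1 / real (i + j + 1))))) {0..1}"
      by (intro has_integral_sum has_integral_mult_right has_integral_power_unit) auto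
    moreover have "(\<Sum>j\<le>N. \<Sum>i\<le>N. coeff u j * (c i * t ^ (i + j))) = poly r t * poly u t" for t
    proof -
      have "poly u t = (\<Sum>j\<le>N. coeff u j * t ^ j)"
        unfolding poly_altdef using u
        by (intro sum.mono_neutral_left) (auto simp: coeff_eq_0)
      then show ?thesis
        by (subst sum.swap) (simp add: poly_r sum_product power_add mult_ac)
    qed
    moreover have "(\<Sum>j\<le>N. \<Sum>i\<le>N. coeff u j * (c i * (1 / real (i + j + 1)))) = poly u 0"
    proof -
      have "(\<Sum>j\<le>N. \<Sum>i\<le>N. coeff u j * (c i * (1 / real (i + j + 1)))) =
          (\<Sum>j\<le>N. coeff u j * (\<Sum>i\<le>N. c i / real (i + j + 1)))"
        by (simp add: sum_distrib_left)
      also have "\<dots> = (\<Sum>j\<le>N. coeff u j * (if j = 0 then 1 else 0))"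
        by (intro sum.cong refl arg_cong2[where f = times] c) simp
      also have "\<dots> = (\<Sum>j\<le>N. if j = 0 then coeff u j else 0)"
        by (intro sum.cong) auto
      also have "\<dots> = poly u 0" by (simp add: poly_0_coeff_0)
      finally show ?thesis .
    qed
    ultimately show "((\<lambda>t. poly r t * poly u t) has_integral poly u 0) {0..1}" by simp
  qed
  ultimately show ?thesis by blast
qed

text \<open>This is Cauchy-Schwarz for u(0) = \<integral> r u, where \<integral> r^2 = r(0) = (N +
  1)^2 by the reproducing property applied to \<open>r\<close> itself.\<close>

lemma poly_trace_inequality_unit:
  fixes u :: "real poly"
  assumes "degree u \<le> N"
  shows "(poly u 0)\<^sup>2 \<le> (real N + 1)\<^sup>2 * integral {0..1} (\<lambda>t. (poly u t)\<^sup>2)"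
proof -
  obtain r :: "real poly" where r: "degree r \<le> N" "poly r 0 = (real N + 1)\<^sup>2"
    and rep: "\<And>u. degree u \<le> N \<Longrightarrow> integral {0..1} (\<lambda>t. poly r t * poly u t) = poly u 0"
    using ex_reproducing_poly_unit by blast
  \<comment> \<open>A multiple of the component of \<open>u\<close> orthogonal to \<open>r\<close>,
    scaled to avoid division. Since \<open>w\<close> vanishes at 0, \<integral> r w = 0, which
    leaves \<integral> w^2 = (N + 1)^2 \<integral> u w.\<close>
  define w where "w = smult ((real N + 1)\<^sup>2) u - smult (poly u 0) r"
  have degw: "degree w \<le> N"
    unfolding w_def using assms r
    by (intro degree_diff_le order.trans[OF degree_smult_le]) auto
  have w0: "poly w 0 = 0" by (simp add: w_def r)
  have ib: "(\<lambda>t. poly p t * poly q t) integrable_on {0..1}" for p q :: "real poly"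
    by (intro integrable_continuous_real continuous_intros)
  have "0 \<le> integral {0..1} (\<lambda>t. (poly w t)\<^sup>2)"
    by (rule integral_nonneg) (auto intro!: integrable_continuous_real continuous_intros)
  also have "\<dots> = integral {0..1} (\<lambda>t. (real N + 1)\<^sup>2 * (poly u t * poly w t) - poly u 0 * (poly r t * poly w t))"
    by (intro arg_cong[where f = "integral {0..1}"] ext) (simp add: w_def power2_eq_square algebra_simps)
  also have "\<dots> = (real N + 1)\<^sup>2 * integral {0..1} (\<lambda>t. poly u t * poly w t)"
    using rep[OF degw] w0
    by (subst integral_diff) (auto intro!: integrable_on_mult_right ib)
  also have "integral {0..1} (\<lambda>t. poly u t * poly w t)
      = integral {0..1} (\<lambda>t. (real N + 1)\<^sup>2 * (poly u t)\<^sup>2 - poly u 0 * (poly r t * poly u t))"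
    by (intro arg_cong[where f = "integral {0..1}"] ext) (simp add: w_def power2_eq_square algebra_simps)
  also have "\<dots> = (real N + 1)\<^sup>2 * integral {0..1} (\<lambda>t. (poly u t)\<^sup>2) - (poly u 0)\<^sup>2"
    using rep[OF assms]
    by (subst integral_diff) (auto intro!: integrable_on_mult_right ib simp: power2_eq_square)
  finally show ?thesis
    by (simp add: zero_le_mult_iff)
qed
subsection \<open>Slicing Lebesgue measure along a direction transversal to a hyperplane\<close>

lemma nn_integral_lborel_translate:
  fixes x :: "'a::euclidean_space"
  assumes [measurable]: "f \<in> borel_measurable borel"
  shows "(\<integral>\<^sup>+y. f (x + y) \<partial>lborel) = (\<integral>\<^sup>+y. f y \<partial>lborel)"
  by (subst (2) lborel_distr_plus[of x, symmetric]) (simp add: nn_integral_distr)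

text \<open>By Fubini's theorem a translation-invariant measure is proportional to Lebesgue measure;
  the even function \<open>g\<close> serves to determine the factor.\<close>

lemma nn_integral_translation_invariant:
  fixes \<Psi> :: "'b \<Rightarrow> 'a::euclidean_space"
  assumes "sigma_finite_measure M" and [measurable]: "\<Psi> \<in> borel_measurable M"
    and inv: "\<And>h x. h \<in> borel_measurable borel \<Longrightarrow>
      (\<integral>\<^sup>+z. h (\<Psi> z + x) \<partial>M) = (\<integral>\<^sup>+z. h (\<Psi> z) \<partial>M :: ennreal)"
    and [measurable]: "f \<in> borel_measurable borel" "g \<in> borel_measurable borel"
    and even: "\<And>x. g (- x) = g x"
  shows "(\<integral>\<^sup>+z. f (\<Psi> z) \<partial>M) * (\<integral>\<^sup>+y. g y \<partial>lborel) = (\<integral>\<^sup>+y. f y \<partial>lborel) * (\<integral>\<^sup>+z. g (\<Psi> z) \<partial>M)"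
proof -
  interpret M: sigma_finite_measure M by fact
  interpret pair_sigma_finite M "lborel :: 'a measure" ..
  \<comment> \<open>The double integral of f(\<Psi> z + y) g(y) is evaluated in both orders. Over
    \<open>z\<close> first, invariance removes \<open>y\<close>; over \<open>y\<close> first, a
    translation by \<Psi> z and the evenness of \<open>g\<close> move the shift from
    \<open>f\<close> to \<open>g\<close>, where invariance removes it as well.\<close>
  have "(\<integral>\<^sup>+z. f (\<Psi> z) \<partial>M) * (\<integral>\<^sup>+y. g y \<partial>lborel) = (\<integral>\<^sup>+y. (\<integral>\<^sup>+z. f (\<Psi> z + y) \<partial>M) * g y \<partial>lborel)"
    by (simp add: inv nn_integral_cmult)
  also have "\<dots> = (\<integral>\<^sup>+y. (\<integral>\<^sup>+z. f (\<Psi> z + y) * g y \<partial>M) \<partial>lborel)"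
    by (simp add: nn_integral_multc)
  also have "\<dots> = (\<integral>\<^sup>+z. (\<integral>\<^sup>+y. f (\<Psi> z + y) * g y \<partial>lborel) \<partial>M)"
    by (rule Fubini') measurable
  also have "\<dots> = (\<integral>\<^sup>+z. (\<integral>\<^sup>+y. f y * g (\<Psi> z - y) \<partial>lborel) \<partial>M)"
  proof (rule nn_integral_cong)
    fix z
    show "(\<integral>\<^sup>+y. f (\<Psi> z + y) * g y \<partial>lborel) = (\<integral>\<^sup>+y. f y * g (\<Psi> z - y) \<partial>lborel)"
      using nn_integral_lborel_translate[of "\<lambda>y. f y * g (\<Psi> z - y)" "\<Psi> z"] by (simp add: even)
  qed
  also have "\<dots> = (\<integral>\<^sup>+y. (\<integral>\<^sup>+z. f y * g (\<Psi> z - y) \<partial>M) \<partial>lborel)"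
    by (rule Fubini'[symmetric]) measurable
  also have "\<dots> = (\<integral>\<^sup>+y. f y * (\<integral>\<^sup>+z. g (\<Psi> z + (- y)) \<partial>M) \<partial>lborel)"
    by (simp add: nn_integral_cmult)
  also have "\<dots> = (\<integral>\<^sup>+y. f y \<partial>lborel) * (\<integral>\<^sup>+z. g (\<Psi> z) \<partial>M)"
    by (subst inv) (simp_all add: nn_integral_multc)
  finally show ?thesis .
qed

text \<open>The even test function: it factors over orthonormal coordinates and has a positive
  finite integral. The exponent 1/4 also fits the later integrability proof, where it is what
  remains of 1/2 after the square of a growth bound with exponent 1/8.\<close>

definition gauss :: "real \<Rightarrow> ennreal" where
  "gauss t = ennreal (exp (- (t\<^sup>2 / 4)))"

lemma measurable_gauss [measurable]: "gauss \<in> borel_measurable borel"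
  unfolding gauss_def by measurable

lemma nn_integral_gauss: "(\<integral>\<^sup>+t. gauss t \<partial>lborel) = ennreal (sqrt (4 * pi))"
proof -
  have "(\<integral>\<^sup>+t. gauss t \<partial>lborel) = (\<integral>\<^sup>+t. ennreal (sqrt (4 * pi)) * ennreal (normal_density 0 (sqrt 2) t) \<partial>lborel)"
    by (intro nn_integral_cong)
       (simp add: gauss_def normal_density_def flip: ennreal_mult)
  also have "\<dots> = ennreal (sqrt (4 * pi)) * ennreal 1"
    by (simp add: nn_integral_cmult nn_integral_eq_integral)
  finally show ?thesis by simp
qed

lemma gauss_norm:
  fixes x :: "'a::euclidean_space"
  shows "gauss (norm x) = (\<Prod>i\<in>Basis. gauss (x \<bullet> i))"
proof -
  have "(norm x)\<^sup>2 = (\<Sum>i\<in>Basis. (x \<bullet> i)\<^sup>2)"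
    by (subst euclidean_inner[of x x, folded power2_norm_eq_inner]) (simp add: power2_eq_square)
  then show ?thesis
    by (simp add: gauss_def prod_ennreal exp_sum[symmetric] sum_negf sum_divide_distrib)
qed

lemma nn_integral_gauss_norm:
  "(\<integral>\<^sup>+x. gauss (norm x) \<partial>(lborel :: 'a::euclidean_space measure)) = ennreal (sqrt (4 * pi)) ^ DIM('a)"
  unfolding gauss_norm by (subst nn_integral_lborel_prod) (simp_all add: nn_integral_gauss)

text \<open>The product measure is determined by its values on boxes, where the shift acts
  coordinatewise. The restriction to \<open>I\<close> keeps the shifted function in the extensional
  function space.\<close>

lemma nn_integral_PiM_translate:
  fixes \<alpha> :: "'i \<Rightarrow> real"
  assumes I: "finite I" and [measurable]: "f \<in> borel_measurable (PiM I (\<lambda>_. lborel))"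
  shows "(\<integral>\<^sup>+\<phi>. f (\<lambda>i\<in>I. \<phi> i + \<alpha> i) \<partial>PiM I (\<lambda>_. lborel)) = (\<integral>\<^sup>+\<phi>. f \<phi> \<partial>PiM I (\<lambda>_. lborel))"
proof -
  interpret product_sigma_finite "\<lambda>_::'i. lborel :: real measure" ..
  let ?P = "PiM I (\<lambda>_. lborel :: real measure)"
  let ?S = "\<lambda>\<phi>. \<lambda>i\<in>I. \<phi> i + \<alpha> i"
  have S [measurable]: "?S \<in> measurable ?P ?P" by measurable
  have "distr ?P ?P ?S = ?P"
  proof (rule PiM_eqI[OF I])
    fix A :: "'i \<Rightarrow> real set"
    assume A: "\<And>i. i \<in> I \<Longrightarrow> A i \<in> sets lborel"
    let ?A = "\<lambda>i. (+) (\<alpha> i) -` A i"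
    have A': "?A i \<in> sets lborel" if "i \<in> I" for i
      using measurable_sets[of "(+) (\<alpha> i)" borel borel "A i"] A[OF that] by simp
    have "emeasure (distr ?P ?P ?S) (Pi\<^sub>E I A) = emeasure ?P (?S -` Pi\<^sub>E I A \<inter> space ?P)"
      using I A by (intro emeasure_distr S sets_PiM_I_finite) auto
    also have "?S -` Pi\<^sub>E I A \<inter> space ?P = Pi\<^sub>E I ?A"
      by (auto simp: space_PiM PiE_def Pi_def add.commute)
    also have "emeasure ?P (Pi\<^sub>E I ?A) = (\<Prod>i\<in>I. emeasure lborel (?A i))"
      using I A' by (rule emeasure_PiM)
    also have "\<dots> = (\<Prod>i\<in>I. emeasure lborel (A i))"
    proof (rule prod.cong[OF refl])
      fix i assume "i \<in> I"
      then show "emeasure lborel (?A i) = emeasure lborel (A i)"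
        using A by (subst (2) lborel_distr_plus[of "\<alpha> i", symmetric]) (simp add: emeasure_distr)
    qed
    finally show "emeasure (distr ?P ?P ?S) (Pi\<^sub>E I A) = (\<Prod>i\<in>I. emeasure lborel (A i))" .
  qed simp
  then have "(\<integral>\<^sup>+\<phi>. f \<phi> \<partial>?P) = (\<integral>\<^sup>+\<phi>. f \<phi> \<partial>distr ?P ?P ?S)" by simp
  also have "\<dots> = (\<integral>\<^sup>+\<phi>. f (?S \<phi>) \<partial>?P)" by (rule nn_integral_distr) measurable
  finally show ?thesis ..
qed

section \<open>Orthonormal coordinates on a hyperplane and the Jacobian of oblique slicing\<close>

lemma orthonormal_basis_of_expand:
  assumes B: "orthonormal_basis_of V B" and x: "x \<in> V"
  shows "finite B" and "(\<Sum>e\<in>B. (x \<bullet> e) *\<^sub>R e) = x"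
proof -
  have po: "pairwise orthogonal B" and n1: "\<And>e. e \<in> B \<Longrightarrow> norm e = 1" and sp: "span B = V"
    using B by (auto simp: orthonormal_basis_of_def)
  have "independent B"
    by (rule pairwise_orthogonal_independent[OF po]) (use n1 in force)
  then show fin: "finite B" by (rule independent_imp_finite)
  obtain u where u: "x = (\<Sum>e\<in>B. u e *\<^sub>R e)"
    using x by (auto simp: span_finite[OF fin] simp flip: sp)
  have "x \<bullet> e = u e" if e: "e \<in> B" for e
  proof -
    have "x \<bullet> e = (\<Sum>e'\<in>B. u e' * (e' \<bullet> e))"
      by (simp add: u inner_sum_left)
    also have "\<dots> = (\<Sum>e'\<in>{e}. u e' * (e' \<bullet> e))"
      by (rule sum.mono_neutral_right)
         (use fin e po in \<open>auto simp: pairwise_def orthogonal_def\<close>)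
    finally show ?thesis using n1[OF e] by (simp add: norm_eq_1)
  qed
  then show "(\<Sum>e\<in>B. (x \<bullet> e) *\<^sub>R e) = x"
    unfolding u[symmetric] by (subst u) (auto intro!: sum.cong)
qed

lemma norm_sum_orthonormal_basis_of:
  fixes x :: "'a::euclidean_space"
  assumes B: "orthonormal_basis_of V B" and fin: "finite B"
  shows "(norm (\<Sum>e\<in>B. \<phi> e *\<^sub>R e))\<^sup>2 = (\<Sum>e\<in>B. (\<phi> e)\<^sup>2)"
proof -
  have po: "pairwise orthogonal B" and n1: "\<And>e. e \<in> B \<Longrightarrow> norm e = 1"
    using B by (auto simp: orthonormal_basis_of_def)
  have "(norm (\<Sum>e\<in>B. \<phi> e *\<^sub>R e))\<^sup>2 = (\<Sum>e\<in>B. (norm (\<phi> e *\<^sub>R e))\<^sup>2)"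
    by (rule norm_sum_Pythagorean[OF fin])
       (use po in \<open>auto simp: pairwise_def orthogonal_def\<close>)
  then show ?thesis by (simp add: n1)
qed

lemma orthonormal_basis_of_hyperplane:
  fixes n :: "'a::euclidean_space"
  assumes n: "n \<noteq> 0" and B: "orthonormal_basis_of {x. n \<bullet> x = 0} B"
  shows "finite B" and "Suc (card B) = DIM('a)"
proof -
  show "finite B"
    using orthonormal_basis_of_expand(1)[OF B, of 0] by simp
  have po: "pairwise orthogonal B" and n1: "\<And>e. e \<in> B \<Longrightarrow> norm e = 1" and sp: "span B = {x. n \<bullet> x = 0}"
    using B by (auto simp: orthonormal_basis_of_def)
  have "independent B"
    by (rule pairwise_orthogonal_independent[OF po]) (use n1 in force)
  then have "card B = dim {x. n \<bullet> x = 0}"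
    unfolding sp[symmetric] by (simp add: dim_eq_card_independent)
  then show "Suc (card B) = DIM('a)"
    using dim_hyperplane[OF n] by simp
qed

text \<open>Since n \<bullet> b \<noteq> 0, every vector is the sum of a hyperplane vector and a
  multiple of \<open>b\<close>. Hence the image of the product measure under these coordinates is
  translation invariant, so a multiple of Lebesgue measure. A Gaussian identifies the factor as the
  height of \<open>b\<close> over the hyperplane, without determinants.\<close>

lemma nn_integral_lborel_orthonormal_slices:
  fixes n b :: "'a::euclidean_space"
  assumes n: "n \<noteq> 0" and nb: "n \<bullet> b \<noteq> 0"
    and B: "orthonormal_basis_of {x. n \<bullet> x = 0} B"
    and f [measurable]: "f \<in> borel_measurable borel"
  shows "(\<integral>\<^sup>+x. f x \<partial>lborel) = ennreal (\<bar>n \<bullet> b\<bar> / norm n) *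
    (\<integral>\<^sup>+\<phi>. (\<integral>\<^sup>+t. f ((\<Sum>e\<in>B. \<phi> e *\<^sub>R e) + t *\<^sub>R b) \<partial>lborel) \<partial>PiM B (\<lambda>_. lborel))"
proof -
  note fin [simp] = orthonormal_basis_of_hyperplane(1)[OF n B]
  let ?P = "PiM B (\<lambda>_. lborel :: real measure)"
  define S where "S \<phi> = (\<Sum>e\<in>B. \<phi> e *\<^sub>R e)" for \<phi>
  have S [measurable]: "S \<in> borel_measurable ?P" unfolding S_def by measurable
  define \<Psi> where "\<Psi> = (\<lambda>(\<phi>, t). S \<phi> + t *\<^sub>R b)"
  have \<Psi> [measurable]: "\<Psi> \<in> borel_measurable (?P \<Otimes>\<^sub>M lborel)" unfolding \<Psi>_def by measurable
  interpret product_sigma_finite "\<lambda>_::'a. lborel :: real measure" ..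
  interpret P: sigma_finite_measure ?P by (rule sigma_finite[OF fin])
  interpret PL: pair_sigma_finite ?P "lborel :: real measure" ..
  have iter: "(\<integral>\<^sup>+z. h (\<Psi> z) \<partial>(?P \<Otimes>\<^sub>M lborel)) = (\<integral>\<^sup>+\<phi>. (\<integral>\<^sup>+t. h (S \<phi> + t *\<^sub>R b) \<partial>lborel) \<partial>?P)"
    if [measurable]: "h \<in> borel_measurable borel" for h :: "'a \<Rightarrow> ennreal"
    by (subst lborel.nn_integral_fst[symmetric]) (simp_all add: \<Psi>_def)
  have S_add: "S \<phi> + y = S (\<lambda>e\<in>B. \<phi> e + y \<bullet> e)" if "n \<bullet> y = 0" for y \<phi>
    using orthonormal_basis_of_expand(2)[OF B, of y] that
    by (simp add: S_def scaleR_add_left sum.distrib)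
  have inv: "(\<integral>\<^sup>+z. h (\<Psi> z + x) \<partial>(?P \<Otimes>\<^sub>M lborel)) = (\<integral>\<^sup>+z. h (\<Psi> z) \<partial>(?P \<Otimes>\<^sub>M lborel))"
    if [measurable]: "h \<in> borel_measurable borel" for h :: "'a \<Rightarrow> ennreal" and x
  proof -
    \<comment> \<open>Splits x = y + \<tau> b with \<open>y\<close> parallel to the hyperplane;
      \<open>y\<close> shifts the coordinates \<phi> and \<tau> shifts \<open>t\<close>.\<close>
    define \<tau> where "\<tau> = (n \<bullet> x) / (n \<bullet> b)"
    define y where "y = x - \<tau> *\<^sub>R b"
    have y: "n \<bullet> y = 0" using nb by (simp add: y_def \<tau>_def inner_diff_right)
    have eq: "S \<phi> + t *\<^sub>R b + x = (S \<phi> + y) + (\<tau> + t) *\<^sub>R b" for \<phi> t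
      by (simp add: y_def algebra_simps)
    have "(\<integral>\<^sup>+z. h (\<Psi> z + x) \<partial>(?P \<Otimes>\<^sub>M lborel)) =
        (\<integral>\<^sup>+\<phi>. (\<integral>\<^sup>+t. h ((S \<phi> + y) + (\<tau> + t) *\<^sub>R b) \<partial>lborel) \<partial>?P)"
      by (subst iter[of "\<lambda>z. h (z + x)"]) (simp_all add: eq)
    also have "\<dots> = (\<integral>\<^sup>+\<phi>. (\<integral>\<^sup>+t. h (S (\<lambda>e\<in>B. \<phi> e + y \<bullet> e) + t *\<^sub>R b) \<partial>lborel) \<partial>?P)"
      unfolding S_add[OF y]
      by (intro nn_integral_cong nn_integral_lborel_translate[of "\<lambda>t. h (_ + t *\<^sub>R b)"]) measurable
    also have "\<dots> = (\<integral>\<^sup>+\<phi>. (\<integral>\<^sup>+t. h (S \<phi> + t *\<^sub>R b) \<partial>lborel) \<partial>?P)"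
      by (rule nn_integral_PiM_translate[OF fin, of "\<lambda>\<phi>. \<integral>\<^sup>+t. h (S \<phi> + t *\<^sub>R b) \<partial>lborel"]) measurable
    also have "\<dots> = (\<integral>\<^sup>+z. h (\<Psi> z) \<partial>(?P \<Otimes>\<^sub>M lborel))" by (simp add: iter)
    finally show ?thesis .
  qed
  \<comment> \<open>The signed length of the normal component of \<open>b\<close>; its absolute
    value will be the Jacobian.\<close>
  define \<beta> where "\<beta> = (n \<bullet> b) / norm n"
  define G where "G = ennreal (sqrt (4 * pi))"
  have \<beta>: "\<beta> \<noteq> 0" using n nb by (simp add: \<beta>_def)
  have gauss_\<Psi>: "gauss (norm (S \<phi> + t *\<^sub>R b)) = (\<Prod>e\<in>B. gauss (\<phi> e + t * (b \<bullet> e))) * gauss (\<beta> * t)" for \<phi> t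
  proof -
    \<comment> \<open>The orthogonal projection of t b onto the hyperplane, so that Pythagoras
      separates the normal direction.\<close>
    define y where "y = t *\<^sub>R (b - (\<beta> / norm n) *\<^sub>R n)"
    have y: "n \<bullet> y = 0"
      using n by (simp add: y_def \<beta>_def inner_diff_right power2_norm_eq_inner[symmetric] power2_eq_square)
    have eq: "S \<phi> + t *\<^sub>R b = (S \<phi> + y) + (t * \<beta> / norm n) *\<^sub>R n"
      by (simp add: y_def algebra_simps)
    have perp: "n \<bullet> e = 0" if "e \<in> B" for e
      using B that span_base[of e B] by (auto simp: orthonormal_basis_of_def)
    have ye: "y \<bullet> e = t * (b \<bullet> e)" if "e \<in> B" for e
      using perp[OF that] by (simp add: y_def inner_diff_left)
    have "n \<bullet> S \<phi> = 0" by (simp add: S_def inner_sum_right perp)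
    then have "orthogonal (S \<phi> + y) ((t * \<beta> / norm n) *\<^sub>R n)"
      using y by (simp add: orthogonal_def inner_commute inner_add_right)
    then have "(norm (S \<phi> + t *\<^sub>R b))\<^sup>2 = (norm (S \<phi> + y))\<^sup>2 + (norm ((t * \<beta> / norm n) *\<^sub>R n))\<^sup>2"
      unfolding eq by (rule norm_add_Pythagorean)
    also have "(norm ((t * \<beta> / norm n) *\<^sub>R n))\<^sup>2 = (\<beta> * t)\<^sup>2"
      using n by (simp add: abs_mult power_mult_distrib)
    also have "(norm (S \<phi> + y))\<^sup>2 = (\<Sum>e\<in>B. (\<phi> e + t * (b \<bullet> e))\<^sup>2)"
      unfolding S_add[OF y] unfolding S_def norm_sum_orthonormal_basis_of[OF B fin]
      by (intro sum.cong) (simp_all add: ye)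
    finally show ?thesis
      by (simp add: gauss_def prod_ennreal exp_sum[symmetric] sum_negf sum_divide_distrib add_divide_distrib
          exp_add[symmetric] flip: ennreal_mult)
  qed
  \<comment> \<open>Integrate over \<phi> first: for fixed \<open>t\<close> the obliqueness of
    \<open>b\<close> only shifts each coordinate, so every factor contributes \<open>G\<close>. The
    remaining integral over \<open>t\<close> contributes \<open>G\<close> divided by
    \<bar>\<beta>\<bar>.\<close>
  have "ennreal \<bar>\<beta>\<bar> * (\<integral>\<^sup>+z. gauss (norm (\<Psi> z)) \<partial>(?P \<Otimes>\<^sub>M lborel)) =
      ennreal \<bar>\<beta>\<bar> * (\<integral>\<^sup>+t. (\<integral>\<^sup>+\<phi>. gauss (norm (S \<phi> + t *\<^sub>R b)) \<partial>?P) \<partial>lborel)"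
    by (subst iter[of "\<lambda>x. gauss (norm x)"], measurable) (subst PL.Fubini', measurable)
  also have "\<dots> = ennreal \<bar>\<beta>\<bar> * (\<integral>\<^sup>+t. G ^ card B * gauss (\<beta> * t) \<partial>lborel)"
  proof (intro arg_cong2[where f = times] refl nn_integral_cong)
    fix t
    have "(\<integral>\<^sup>+\<phi>. gauss (norm (S \<phi> + t *\<^sub>R b)) \<partial>?P) =
        (\<integral>\<^sup>+\<phi>. (\<Prod>e\<in>B. gauss (\<phi> e + t * (b \<bullet> e))) \<partial>?P) * gauss (\<beta> * t)"
      unfolding gauss_\<Psi> by (rule nn_integral_multc) measurable
    also have "(\<integral>\<^sup>+\<phi>. (\<Prod>e\<in>B. gauss (\<phi> e + t * (b \<bullet> e))) \<partial>?P) =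
        (\<Prod>e\<in>B. \<integral>\<^sup>+x. gauss (x + t * (b \<bullet> e)) \<partial>lborel)"
      by (rule product_nn_integral_prod[OF fin]) measurable
    also have "\<dots> = (\<Prod>e\<in>B. G)"
      using nn_integral_lborel_translate[of gauss "t * (b \<bullet> _)"]
      by (simp add: add.commute nn_integral_gauss G_def)
    finally show "(\<integral>\<^sup>+\<phi>. gauss (norm (S \<phi> + t *\<^sub>R b)) \<partial>?P) = G ^ card B * gauss (\<beta> * t)"
      by simp
  qed
  also have "\<dots> = G ^ card B * (ennreal \<bar>\<beta>\<bar> * (\<integral>\<^sup>+t. gauss (\<beta> * t) \<partial>lborel))"
    by (subst nn_integral_cmult) (simp_all add: mult_ac)
  also have "ennreal \<bar>\<beta>\<bar> * (\<integral>\<^sup>+t. gauss (\<beta> * t) \<partial>lborel) = G"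
    using nn_integral_real_affine[OF measurable_gauss \<beta>, of 0] by (simp add: nn_integral_gauss G_def)
  also have "G ^ card B * G = G ^ DIM('a)"
    by (simp add: mult.commute flip: orthonormal_basis_of_hyperplane(2)[OF n B])
  finally have norm\<Psi>: "ennreal \<bar>\<beta>\<bar> * (\<integral>\<^sup>+z. gauss (norm (\<Psi> z)) \<partial>(?P \<Otimes>\<^sub>M lborel)) = G ^ DIM('a)" .
  have "(\<integral>\<^sup>+z. f (\<Psi> z) \<partial>(?P \<Otimes>\<^sub>M lborel)) * G ^ DIM('a) =
      (\<integral>\<^sup>+x. f x \<partial>lborel) * (\<integral>\<^sup>+z. gauss (norm (\<Psi> z)) \<partial>(?P \<Otimes>\<^sub>M lborel))"
    using nn_integral_translation_invariant[OF _ \<Psi> inv f, of "\<lambda>x. gauss (norm x)"]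
    by (simp add: nn_integral_gauss_norm G_def PL.sigma_finite_measure_axioms)
  then have "ennreal \<bar>\<beta>\<bar> * (\<integral>\<^sup>+z. f (\<Psi> z) \<partial>(?P \<Otimes>\<^sub>M lborel)) * G ^ DIM('a) =
      (\<integral>\<^sup>+x. f x \<partial>lborel) * G ^ DIM('a)"
    by (simp add: mult_ac flip: norm\<Psi>)
  \<comment> \<open>Positive and finite, so the Gaussian integral may be cancelled in
    \<open>ennreal\<close>.\<close>
  moreover have "G ^ DIM('a) \<noteq> 0" "G ^ DIM('a) \<noteq> top"
    by (simp_all add: G_def ennreal_power)
  ultimately have "ennreal \<bar>\<beta>\<bar> * (\<integral>\<^sup>+z. f (\<Psi> z) \<partial>(?P \<Otimes>\<^sub>M lborel)) = (\<integral>\<^sup>+x. f x \<partial>lborel)"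
    by (metis ennreal_mult_cancel_left mult.commute)
  then show ?thesis by (simp add: iter \<beta>_def S_def)
qed

text \<open>A translation by the base point moves the hyperplane to the origin. Of the choices made
  in \<open>affine_lborel\<close> the argument uses just that the point lies on the hyperplane and
  that \<open>B\<close> is an orthonormal basis of its direction space.\<close>

lemma nn_integral_lborel_hyperplane_slices:
  fixes n b :: "'a::euclidean_space"
  assumes n: "n \<noteq> 0" and nb: "n \<bullet> b \<noteq> 0"
    and f [measurable]: "f \<in> borel_measurable borel"
  shows "(\<integral>\<^sup>+x. f x \<partial>lborel) = ennreal (\<bar>n \<bullet> b\<bar> / norm n) *
    (\<integral>\<^sup>+s. (\<integral>\<^sup>+t. f (s + t *\<^sub>R b) \<partial>lborel) \<partial>affine_lborel {x. n \<bullet> x = c})"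
proof -
  define a where "a = (SOME a. a \<in> {x. n \<bullet> x = c})"
  define B where "B = (SOME B. orthonormal_basis_of {x - a |x. x \<in> {x. n \<bullet> x = c}} B)"
  \<comment> \<open>The foot of the perpendicular from the origin shows that the choice of
    \<open>a\<close> is from a nonempty set.\<close>
  have "(c / (n \<bullet> n)) *\<^sub>R n \<in> {x. n \<bullet> x = c}" using n by simp
  then have a: "n \<bullet> a = c" unfolding a_def by (rule someI2) simp
  have V: "{x - a |x. x \<in> {x. n \<bullet> x = c}} = {x. n \<bullet> x = 0}"
  proof (intro equalityI subsetI)
    fix y assume "y \<in> {x. n \<bullet> x = 0}"
    then show "y \<in> {x - a |x. x \<in> {x. n \<bullet> x = c}}"
      using a by (intro CollectI exI[of _ "y + a"]) (simp add: inner_add_right)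
  qed (use a in \<open>auto simp: inner_diff_right\<close>)
  have B: "orthonormal_basis_of {x. n \<bullet> x = 0} B"
  proof -
    obtain B' where "orthonormal_basis_of {x. n \<bullet> x = 0} B'"
      using orthonormal_basis_subspace[OF subspace_hyperplane[of n]]
      unfolding orthonormal_basis_of_def by metis
    then show ?thesis unfolding B_def V by (rule someI)
  qed
  have fin: "finite B" by (rule orthonormal_basis_of_hyperplane(1)[OF n B])
  have A: "affine_lborel {x. n \<bullet> x = c} =
      distr (PiM B (\<lambda>_. lborel)) borel (\<lambda>\<phi>. a + (\<Sum>e\<in>B. \<phi> e *\<^sub>R e))"
    unfolding affine_lborel_def Let_def a_def[symmetric] B_def[symmetric] ..
  have "(\<integral>\<^sup>+x. f x \<partial>lborel) = (\<integral>\<^sup>+x. f (a + x) \<partial>lborel)"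
    by (simp add: nn_integral_lborel_translate)
  also have "\<dots> = ennreal (\<bar>n \<bullet> b\<bar> / norm n) *
    (\<integral>\<^sup>+\<phi>. (\<integral>\<^sup>+t. f (a + ((\<Sum>e\<in>B. \<phi> e *\<^sub>R e) + t *\<^sub>R b)) \<partial>lborel) \<partial>PiM B (\<lambda>_. lborel))"
    by (rule nn_integral_lborel_orthonormal_slices[OF n nb B, of "\<lambda>x. f (a + x)"]) measurable
  finally show ?thesis
    unfolding A by (subst nn_integral_distr) (simp_all add: add.assoc)
qed

subsection \<open>The inequality on rays\<close>

lemma measurable_poly [measurable]: "poly (q :: real poly) \<in> borel_measurable borel"
  by (intro borel_measurable_continuous_onI continuous_intros)

text \<open>Since \<open>(1 - t) ^ (2 * m) \<le> exp (- D * t)\<close> for \<open>2 * m \<ge> D\<close>, the factor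
  \<open>(1 - t) ^ m\<close> turns the exponential weight into a polynomial one at the cost of \<open>m\<close>
  additional degrees.\<close>

lemma poly_trace_inequality_exp:
  fixes q :: "real poly"
  assumes q: "degree q \<le> p" and D: "D \<le> 2 * real m"
  shows "ennreal ((poly q 0)\<^sup>2) \<le> ennreal ((real (p + m) + 1)\<^sup>2) *
    (\<integral>\<^sup>+t. ennreal ((poly q t)\<^sup>2 * exp (- (D * t))) * indicator {0<..1} t \<partial>lborel)"
proof -
  \<comment> \<open>The polynomial q(t) (1 - t)^m, whose value at 0 is still q(0).\<close>
  define u where "u = q * [:1, -1:] ^ m"
  have "degree u \<le> p + m"
    unfolding u_def using q degree_power_le[of "[:1, -1 :: real:]" m]
    by (intro order.trans[OF degree_mult_le]) simp
  note trace = poly_trace_inequality_unit[OF this]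
  have int: "(\<lambda>t. (poly u t)\<^sup>2) integrable_on {0..1}"
    by (intro integrable_continuous_real continuous_intros)
  have "ennreal (integral {0..1} (\<lambda>t. (poly u t)\<^sup>2)) = (\<integral>\<^sup>+t. ennreal (indicator {0..1} t * (poly u t)\<^sup>2) \<partial>lborel)"
  proof (rule nn_integral_has_integral_lborel[symmetric])
    show "(\<lambda>t. indicator {0..1} t * (poly u t)\<^sup>2) \<in> borel_measurable borel" by measurable
    have "((\<lambda>t. if t \<in> {0..1} then (poly u t)\<^sup>2 else 0) has_integral integral {0..1} (\<lambda>t. (poly u t)\<^sup>2)) UNIV"
      unfolding has_integral_restrict_UNIV using int by (rule integrable_integral)
    then show "((\<lambda>t. indicator {0..1} t * (poly u t)\<^sup>2) has_integral integral {0..1} (\<lambda>t. (poly u t)\<^sup>2)) UNIV"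
      by (rule has_integral_eq[rotated]) auto
  qed auto
  also have "\<dots> \<le> (\<integral>\<^sup>+t. ennreal ((poly q t)\<^sup>2 * exp (- (D * t))) * indicator {0<..1} t \<partial>lborel)"
  proof (rule nn_integral_mono_AE)
    have *: "(poly u t)\<^sup>2 \<le> (poly q t)\<^sup>2 * exp (- (D * t))" if t: "0 \<le> t" "t \<le> 1" for t
    proof -
      have "((1 - t) ^ m)\<^sup>2 = (1 - t) ^ (2 * m)" by (simp add: power_mult mult.commute)
      also have "\<dots> \<le> exp (- t) ^ (2 * m)"
        using t exp_ge_add_one_self[of "- t"] by (intro power_mono) auto
      also have "\<dots> = exp (- (2 * real m * t))" by (simp flip: exp_of_nat_mult)
      also have "\<dots> \<le> exp (- (D * t))" using D t by (simp add: mult_right_mono)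
      finally show ?thesis
        by (simp add: u_def power_mult_distrib poly_power mult_left_mono)
    qed
    \<comment> \<open>The endpoint 0 is discarded as a null set, because an infinite element
      contains only points with t > 0.\<close>
    have "AE t in lborel. t \<noteq> (0::real)" by (rule AE_lborel_singleton)
    then show "AE t in lborel. ennreal (indicator {0..1} t * (poly u t)\<^sup>2) \<le>
        ennreal ((poly q t)\<^sup>2 * exp (- (D * t))) * indicator {0<..1} t"
      by eventually_elim (auto simp: indicator_def * intro!: ennreal_leI)
  qed
  finally have le: "ennreal (integral {0..1} (\<lambda>t. (poly u t)\<^sup>2)) \<le>
    (\<integral>\<^sup>+t. ennreal ((poly q t)\<^sup>2 * exp (- (D * t))) * indicator {0<..1} t \<partial>lborel)" .
  have "ennreal ((poly q 0)\<^sup>2) \<le> ennreal ((real (p + m) + 1)\<^sup>2 * integral {0..1} (\<lambda>t. (poly u t)\<^sup>2))"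
    using trace by (intro ennreal_leI) (simp add: u_def poly_power)
  also have "\<dots> = ennreal ((real (p + m) + 1)\<^sup>2) * ennreal (integral {0..1} (\<lambda>t. (poly u t)\<^sup>2))"
    by (intro ennreal_mult integral_nonneg int) auto
  also note mult_left_mono[OF le]
  finally show ?thesis by simp
qed

text \<open>The point at distance h t is a convex combination of \<open>s\<close> and s + h b, and
  the latter has norm at most \<open>M\<close>. Convexity of the even power bounds the exponent by
  (1 - t) \<bar>s\<bar>^(2k) + t M^(2k); replacing 1 - t by 1 splits off the weight at
  \<open>s\<close>.\<close>

lemma exp_weight_ray_ge:
  fixes s b :: "'a::euclidean_space"
  assumes b: "norm b = 1" and h: "h \<ge> 0" and s: "norm s + h \<le> M" and t: "0 \<le> t" "t \<le> 1" and k: "k \<ge> 1"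
  shows "exp_weight k (s + (h * t) *\<^sub>R b) \<ge> exp_weight k s * exp (- (M ^ (2 * k) / (2 * real k) * t))"
proof -
  have "norm (s + (h * t) *\<^sub>R b) = norm ((1 - t) *\<^sub>R s + t *\<^sub>R (s + h *\<^sub>R b))"
    by (simp add: algebra_simps)
  also have "\<dots> \<le> (1 - t) * norm s + t * norm (s + h *\<^sub>R b)"
    using t by (intro order.trans[OF norm_triangle_ineq]) simp
  also have "norm (s + h *\<^sub>R b) \<le> M"
    using norm_triangle_ineq[of s "h *\<^sub>R b"] b h s by simp
  finally have "norm (s + (h * t) *\<^sub>R b) \<le> (1 - t) * norm s + t * M"
    using t by (simp add: mult_left_mono)
  then have "norm (s + (h * t) *\<^sub>R b) ^ (2 * k) \<le> ((1 - t) * norm s + t * M) ^ (2 * k)"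
    by (intro power_mono) auto
  also have "\<dots> \<le> (1 - t) * norm s ^ (2 * k) + t * M ^ (2 * k)"
    using convex_onD[OF convex_power_even[of "2 * k"], of t "norm s" M] t by simp
  also have "\<dots> \<le> norm s ^ (2 * k) + M ^ (2 * k) * t"
    using t by (simp add: algebra_simps)
  finally have "norm (s + (h * t) *\<^sub>R b) ^ (2 * k) / (2 * real k) \<le>
      (norm s ^ (2 * k) + M ^ (2 * k) * t) / (2 * real k)"
    by (intro divide_right_mono) auto
  then show ?thesis
    by (simp add: exp_weight_def add_divide_distrib flip: exp_add)
qed

text \<open>Each coordinate becomes a polynomial of degree at most 1 in \<open>t\<close>, so a
  monomial has at most its total degree on the line.\<close>

lemma polynomials_deg_le_line:
  fixes s b :: "'a::euclidean_space"
  assumes "v \<in> polynomials_deg_le p"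
  shows "\<exists>q. degree q \<le> p \<and> (\<forall>t. poly q t = v (s + t *\<^sub>R b))"
proof -
  obtain c where c: "\<And>x. v x = (\<Sum>\<alpha>\<in>multi_indices p. c \<alpha> * (\<Prod>i\<in>Basis. (x \<bullet> i) ^ \<alpha> i))"
    using assms by (auto simp: polynomials_deg_le_def)
  define q where "q = (\<Sum>\<alpha>\<in>multi_indices p. smult (c \<alpha>) (\<Prod>i\<in>Basis. [:s \<bullet> i, b \<bullet> i:] ^ \<alpha> i))"
  have fin: "finite (multi_indices p :: ('a \<Rightarrow> nat) set)"
    unfolding multi_indices_def
    by (rule finite_subset[of _ "Basis \<rightarrow>\<^sub>E {..p}"]) (auto intro: finite_PiE)
  have "degree q \<le> p"
    unfolding q_def
  proof (rule degree_sum_le[OF fin])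
    fix \<alpha> :: "'a \<Rightarrow> nat" assume \<alpha>: "\<alpha> \<in> multi_indices p"
    have "degree (\<Prod>i\<in>Basis. [:s \<bullet> i, b \<bullet> i:] ^ \<alpha> i) \<le> (\<Sum>i\<in>Basis. degree ([:s \<bullet> i, b \<bullet> i:] ^ \<alpha> i))"
      using degree_prod_sum_le[of Basis "\<lambda>i. [:s \<bullet> i, b \<bullet> i:] ^ \<alpha> i"] by simp
    also have "\<dots> \<le> (\<Sum>i\<in>Basis. \<alpha> i)"
    proof (rule sum_mono)
      fix i
      have "degree ([:s \<bullet> i, b \<bullet> i:] ^ \<alpha> i) \<le> degree [:s \<bullet> i, b \<bullet> i:] * \<alpha> i" by (rule degree_power_le)
      also have "\<dots> \<le> \<alpha> i" by simp
      finally show "degree ([:s \<bullet> i, b \<bullet> i:] ^ \<alpha> i) \<le> \<alpha> i" .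
    qed
    also have "\<dots> \<le> p" using \<alpha> by (simp add: multi_indices_def)
    finally show "degree (smult (c \<alpha>) (\<Prod>i\<in>Basis. [:s \<bullet> i, b \<bullet> i:] ^ \<alpha> i)) \<le> p"
      using degree_smult_le order.trans by blast
  qed
  moreover have "poly q t = v (s + t *\<^sub>R b)" for t
    by (simp add: q_def c poly_sum poly_prod poly_power inner_add_left)
  ultimately show ?thesis by blast
qed

lemma polynomials_deg_le_borel:
  assumes "v \<in> polynomials_deg_le p"
  shows "v \<in> borel_measurable borel"
proof -
  obtain c where c: "\<And>x. v x = (\<Sum>\<alpha>\<in>multi_indices p. c \<alpha> * (\<Prod>i\<in>Basis. (x \<bullet> i) ^ \<alpha> i))"
    using assms by (auto simp: polynomials_deg_le_def)
  show ?thesis unfolding c[abs_def] by measurable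
qed

lemma measurable_exp_weight [measurable]: "exp_weight k \<in> borel_measurable borel"
  unfolding exp_weight_def by measurable

text \<open>Only the initial segment of length \<open>h\<close> of the ray is used. Scaling it to
  the unit interval produces the factor 1 / h, and the rest of the ray contributes a nonnegative
  amount.\<close>

lemma infinite_element_ray_ge:
  fixes s b :: "'a::euclidean_space"
  assumes v: "v \<in> polynomials_deg_le p" and b: "norm b = 1" and h: "h > 0" and k: "k \<ge> 1"
    and sF: "s \<in> F" and s: "norm s + h \<le> M" and m: "M ^ (2 * k) / (2 * real k) \<le> 2 * real m"
    and T: "infinite_element F b \<in> sets borel"
  shows "ennreal ((v s)\<^sup>2 * exp_weight k s) \<le> ennreal ((real (p + m) + 1)\<^sup>2 / h) *
    (\<integral>\<^sup>+t. ennreal (indicator (infinite_element F b) (s + t *\<^sub>R b) *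
       ((v (s + t *\<^sub>R b))\<^sup>2 * exp_weight k (s + t *\<^sub>R b))) \<partial>lborel)"
proof -
  note [measurable] = polynomials_deg_le_borel[OF v] T
  define D where "D = M ^ (2 * k) / (2 * real k)"
  define f where "f x = ennreal (indicator (infinite_element F b) x * ((v x)\<^sup>2 * exp_weight k x))" for x
  have f [measurable]: "f \<in> borel_measurable borel" unfolding f_def by measurable
  obtain q where q: "degree q \<le> p" "\<And>t. poly q t = v (s + t *\<^sub>R (h *\<^sub>R b))"
    using polynomials_deg_le_line[OF v] by blast
  have q0: "poly q 0 = v s" by (simp add: q)
  let ?I = "\<integral>\<^sup>+t. ennreal ((poly q t)\<^sup>2 * exp (- (D * t))) * indicator {0<..1} t \<partial>lborel"
  have w0: "exp_weight k x \<ge> 0" for x :: 'a by (simp add: exp_weight_def)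
  have "ennreal (exp_weight k s) * ?I =
      (\<integral>\<^sup>+t. ennreal (exp_weight k s) * (ennreal ((poly q t)\<^sup>2 * exp (- (D * t))) * indicator {0<..1} t) \<partial>lborel)"
    by (rule nn_integral_cmult[symmetric]) measurable
  also have "\<dots> \<le> (\<integral>\<^sup>+t. f (s + (h * t) *\<^sub>R b) \<partial>lborel)"
  proof (rule nn_integral_mono)
    fix t :: real
    show "ennreal (exp_weight k s) * (ennreal ((poly q t)\<^sup>2 * exp (- (D * t))) * indicator {0<..1} t)
      \<le> f (s + (h * t) *\<^sub>R b)"
    proof (cases "t \<in> {0<..1}")
      case True
      have "s + (h * t) *\<^sub>R b \<in> infinite_element F b"
        unfolding infinite_element_def using sF True h by (auto intro!: exI[of _ s] exI[of _ "h * t"])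
      moreover have "exp_weight k s * ((poly q t)\<^sup>2 * exp (- (D * t))) \<le>
          (v (s + (h * t) *\<^sub>R b))\<^sup>2 * exp_weight k (s + (h * t) *\<^sub>R b)"
        using mult_left_mono[OF exp_weight_ray_ge[OF b _ s _ _ k, of t], of "(poly q t)\<^sup>2"] True h
        by (simp add: q D_def mult_ac)
      ultimately show ?thesis using True w0
        by (simp add: f_def ennreal_leI flip: ennreal_mult)
    qed simp
  qed
  finally have le: "ennreal (exp_weight k s) * ?I \<le> (\<integral>\<^sup>+t. f (s + (h * t) *\<^sub>R b) \<partial>lborel)" .
  have "ennreal ((v s)\<^sup>2 * exp_weight k s) = ennreal (exp_weight k s) * ennreal ((poly q 0)\<^sup>2)"
    using w0 by (simp add: q0 mult.commute flip: ennreal_mult)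
  also have "\<dots> \<le> ennreal (exp_weight k s) * (ennreal ((real (p + m) + 1)\<^sup>2) * ?I)"
    by (intro mult_left_mono poly_trace_inequality_exp q(1)) (use m D_def in auto)
  also have "\<dots> \<le> ennreal ((real (p + m) + 1)\<^sup>2) * (\<integral>\<^sup>+t. f (s + (h * t) *\<^sub>R b) \<partial>lborel)"
    using mult_left_mono[OF le, of "ennreal ((real (p + m) + 1)\<^sup>2)"] by (simp add: mult_ac)
  also have "\<dots> = ennreal ((real (p + m) + 1)\<^sup>2 / h) * (\<integral>\<^sup>+t. f (s + t *\<^sub>R b) \<partial>lborel)"
  proof -
    have "(\<integral>\<^sup>+t. f (s + t *\<^sub>R b) \<partial>lborel) = ennreal h * (\<integral>\<^sup>+t. f (s + (h * t) *\<^sub>R b) \<partial>lborel)"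
      using nn_integral_real_affine[of "\<lambda>t. f (s + t *\<^sub>R b)" h 0] h by simp
    then show ?thesis using h by (simp add: mult.assoc[symmetric] flip: ennreal_mult)
  qed
  finally show ?thesis unfolding f_def .
qed

text \<open>By transversality a point determines its height \<tau> over the base hyperplane and its
  foot point along \<open>b\<close>. Both are Borel functions, so the element is a preimage of Borel
  sets.\<close>

lemma infinite_element_borel:
  fixes n b :: "'a::euclidean_space"
  assumes [measurable]: "F \<in> sets borel" and F: "F \<subseteq> {x. n \<bullet> x = c}" and nb: "n \<bullet> b \<noteq> 0"
  shows "infinite_element F b \<in> sets borel"
proof -
  define \<tau> where "\<tau> x = (n \<bullet> x - c) / (n \<bullet> b)" for x
  have [measurable]: "\<tau> \<in> borel_measurable borel" unfolding \<tau>_def by measurable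
  have "infinite_element F b = {x. x - \<tau> x *\<^sub>R b \<in> F \<and> \<tau> x > 0}"
  proof (intro equalityI subsetI)
    fix x assume "x \<in> infinite_element F b"
    then obtain s t where "x = s + t *\<^sub>R b" "s \<in> F" "t > 0" by (auto simp: infinite_element_def)
    moreover from this have "\<tau> x = t" using F nb by (auto simp: \<tau>_def inner_add_right)
    ultimately show "x \<in> {x. x - \<tau> x *\<^sub>R b \<in> F \<and> \<tau> x > 0}" by simp
  next
    fix x assume "x \<in> {x. x - \<tau> x *\<^sub>R b \<in> F \<and> \<tau> x > 0}"
    then show "x \<in> infinite_element F b"
      unfolding infinite_element_def
      by (intro CollectI exI[of _ "x - \<tau> x *\<^sub>R b"] exI[of _ "\<tau> x"]) simp
  qed
  also have "\<dots> \<in> sets borel" by measurable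
  finally show ?thesis .
qed

lemma infinite_element_scaleR:
  assumes "r > 0"
  shows "infinite_element F (r *\<^sub>R b) = infinite_element F b"
proof (intro equalityI subsetI)
  fix x assume "x \<in> infinite_element F (r *\<^sub>R b)"
  then obtain s t where "x = s + (t * r) *\<^sub>R b" "s \<in> F" "t > 0" by (auto simp: infinite_element_def)
  then show "x \<in> infinite_element F b"
    using assms unfolding infinite_element_def by (intro CollectI exI[of _ s] exI[of _ "t * r"]) simp
next
  fix x assume "x \<in> infinite_element F b"
  then obtain s t where "x = s + t *\<^sub>R b" "s \<in> F" "t > 0" by (auto simp: infinite_element_def)
  then show "x \<in> infinite_element F (r *\<^sub>R b)"
    using assms unfolding infinite_element_def by (intro CollectI exI[of _ s] exI[of _ "t / r"]) simp
qed

subsection \<open>Integrability and conclusion\<close>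

text \<open>Serves integrability. The exponent 1/8 makes the square grow like exp(\<bar>x\<bar>^2 /
  4), which a Gaussian weight with exponent 1/2 still dominates.\<close>

lemma polynomials_deg_le_growth:
  fixes v :: "'a::euclidean_space \<Rightarrow> real"
  assumes "v \<in> polynomials_deg_le p"
  shows "\<exists>K. \<forall>x. \<bar>v x\<bar> \<le> K * exp ((norm x)\<^sup>2 / 8)"
proof -
  obtain c where c: "\<And>x. v x = (\<Sum>\<alpha>\<in>multi_indices p. c \<alpha> * (\<Prod>i\<in>Basis. (x \<bullet> i) ^ \<alpha> i))"
    using assms by (auto simp: polynomials_deg_le_def)
  \<comment> \<open>One term of the exponential series gives r^m \<le> m! exp(r), and (r - 4)^2
    \<ge> 0 gives r \<le> 2 + r^2 / 8.\<close>
  have power_le: "r ^ m \<le> fact m * exp 2 * exp (r\<^sup>2 / 8)" if r: "r \<ge> 0" for r :: real and m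
  proof -
    have "inverse (fact m) *\<^sub>R r ^ m \<le> (\<Sum>n. inverse (fact n) *\<^sub>R r ^ n)"
      using r sum_le_suminf[OF summable_exp_generic[of r], of "{m}"] by simp
    then have "r ^ m \<le> fact m * exp r"
      by (simp add: exp_def field_simps)
    moreover have "r \<le> 2 + r\<^sup>2 / 8"
      using zero_le_power2[of "r - 4"] by (simp add: power2_eq_square algebra_simps)
    then have "exp r \<le> exp 2 * exp (r\<^sup>2 / 8)" by (simp flip: exp_add)
    ultimately show ?thesis
      by (metis (no_types, lifting) fact_ge_zero mult.assoc mult_left_mono order.trans)
  qed
  have "\<bar>v x\<bar> \<le> (\<Sum>\<alpha>\<in>multi_indices p. \<bar>c \<alpha>\<bar> * (fact (sum \<alpha> Basis) * exp 2)) * exp ((norm x)\<^sup>2 / 8)" for x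
  proof -
    have "\<bar>v x\<bar> \<le> (\<Sum>\<alpha>\<in>multi_indices p. \<bar>c \<alpha>\<bar> * \<bar>\<Prod>i\<in>Basis. (x \<bullet> i) ^ \<alpha> i\<bar>)"
      unfolding c by (intro order.trans[OF sum_abs]) (simp add: abs_mult)
    also have "\<dots> \<le> (\<Sum>\<alpha>\<in>multi_indices p. \<bar>c \<alpha>\<bar> * (fact (sum \<alpha> Basis) * exp 2 * exp ((norm x)\<^sup>2 / 8)))"
    proof (intro sum_mono mult_left_mono)
      fix \<alpha> :: "'a \<Rightarrow> nat"
      have "\<bar>\<Prod>i\<in>Basis. (x \<bullet> i) ^ \<alpha> i\<bar> \<le> (\<Prod>i\<in>Basis. norm x ^ \<alpha> i)"
        unfolding abs_prod power_abs by (intro prod_mono conjI power_mono Basis_le_norm) auto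
      also have "\<dots> = norm x ^ sum \<alpha> Basis" by (simp add: power_sum)
      also note power_le[OF norm_ge_zero]
      finally show "\<bar>\<Prod>i\<in>Basis. (x \<bullet> i) ^ \<alpha> i\<bar> \<le> fact (sum \<alpha> Basis) * exp 2 * exp ((norm x)\<^sup>2 / 8)" .
    qed simp
    finally show ?thesis by (simp add: sum_distrib_right mult.assoc)
  qed
  then show ?thesis by blast
qed

text \<open>Bernoulli's inequality for y = \<bar>x\<bar>^2 gives y^k \<ge> k (y - 1), which reduces
  every \<open>k\<close> to the Gaussian case k = 1 up to a constant.\<close>

lemma exp_weight_le_gaussian:
  assumes k: "k \<ge> 1"
  shows "exp_weight k x \<le> exp (1 / 2) * exp (- ((norm x)\<^sup>2 / 2))"
proof -
  define y where "y = (norm x)\<^sup>2"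
  have "1 + real k * (y - 1) \<le> (1 + (y - 1)) ^ k"
    by (rule Bernoulli_inequality) (simp add: y_def)
  then have "real k * (y - 1) \<le> norm x ^ (2 * k)"
    by (simp add: y_def power_mult)
  then have "real k * (y - 1) / (2 * real k) \<le> norm x ^ (2 * k) / (2 * real k)"
    by (rule divide_right_mono) simp
  then show ?thesis
    using k by (simp add: exp_weight_def y_def diff_divide_distrib flip: exp_add)
qed

text \<open>Needed to return from nonnegative integrals to Bochner integrals:
  \<open>enn2real\<close> sends infinity to 0, so it is monotone only below a finite bound.\<close>

lemma nn_integral_polynomial_exp_weight_finite:
  fixes v :: "'a::euclidean_space \<Rightarrow> real"
  assumes v: "v \<in> polynomials_deg_le p" and k: "k \<ge> 1"
  shows "(\<integral>\<^sup>+x. ennreal ((v x)\<^sup>2 * exp_weight k x) \<partial>lborel) < \<infinity>"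
proof -
  obtain K where K: "\<And>x. \<bar>v x\<bar> \<le> K * exp ((norm x)\<^sup>2 / 8)"
    using polynomials_deg_le_growth[OF v] by blast
  have "ennreal ((v x)\<^sup>2 * exp_weight k x) \<le> ennreal (K\<^sup>2 * exp (1 / 2)) * gauss (norm x)" for x
  proof -
    have "(v x)\<^sup>2 \<le> (K * exp ((norm x)\<^sup>2 / 8))\<^sup>2"
      using power_mono[OF K[of x], of 2] by simp
    then have "(v x)\<^sup>2 * exp_weight k x \<le>
        (K * exp ((norm x)\<^sup>2 / 8))\<^sup>2 * (exp (1 / 2) * exp (- ((norm x)\<^sup>2 / 2)))"
      by (intro mult_mono exp_weight_le_gaussian k) (auto simp: exp_weight_def)
    also have "\<dots> = K\<^sup>2 * exp (1 / 2) * exp (- ((norm x)\<^sup>2 / 4))"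
      by (simp add: power_mult_distrib flip: exp_add exp_of_nat_mult exp_double)
    finally show ?thesis
      by (simp add: gauss_def ennreal_leI flip: ennreal_mult)
  qed
  then have "(\<integral>\<^sup>+x. ennreal ((v x)\<^sup>2 * exp_weight k x) \<partial>lborel) \<le>
      (\<integral>\<^sup>+x. ennreal (K\<^sup>2 * exp (1 / 2)) * gauss (norm x) \<partial>(lborel :: 'a measure))"
    by (intro nn_integral_mono)
  also have "\<dots> = ennreal (K\<^sup>2 * exp (1 / 2)) * ennreal (sqrt (4 * pi)) ^ DIM('a)"
    by (simp add: nn_integral_cmult nn_integral_gauss_norm)
  also have "\<dots> < \<infinity>"
    by (simp add: ennreal_power flip: ennreal_mult)
  finally show ?thesis .
qed

section \<open>Integration of the ray inequality over the base\<close>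

theorem lemma5p9:
  fixes p k :: nat
    and n b :: "'a::euclidean_space" and c :: real
    and F :: "'a set" and \<Theta> :: "real set"
    and v :: "'a \<Rightarrow> real"
  assumes "p \<ge> 1" and "k \<ge> 1"
    and "n \<noteq> 0" and "F \<subseteq> {x. n \<bullet> x = c}"
    and "aff_dim F = int DIM('a) - 1" and "bounded F" and "F \<in> sets borel"
    and "n \<bullet> b \<noteq> 0"
    and "finite \<Theta>" and "\<Theta> \<subseteq> {0<..<pi}" and "axis_angle n b \<in> \<Theta>"
    and "v \<in> polynomials_deg_le p"
  shows "(LINT s:F|affine_lborel {x. n \<bullet> x = c}. (v s)\<^sup>2 * exp_weight k s)
    \<le> c_inv p k (radius_of_base F) \<Theta> * real p powr (2 - 1 / (2 * real k))
        * (LINT x:infinite_element F b|lborel. (v x)\<^sup>2 * exp_weight k x)"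
proof -
  let ?A = "affine_lborel {x. n \<bullet> x = c}"
  let ?g = "\<lambda>x. (v x)\<^sup>2 * exp_weight k x"
  let ?T = "infinite_element F b"
  \<comment> \<open>With a unit axis, \<open>h\<close> is a length along the ray and the Jacobian of
    the slicing is exactly the sine of the axis angle.\<close>
  define b' where "b' = (1 / norm b) *\<^sub>R b"
  have "b \<noteq> 0" using \<open>n \<bullet> b \<noteq> 0\<close> by auto
  have b': "norm b' = 1" and nb': "n \<bullet> b' \<noteq> 0" and T': "infinite_element F b' = ?T"
    using \<open>b \<noteq> 0\<close> \<open>n \<bullet> b \<noteq> 0\<close> by (simp_all add: b'_def infinite_element_scaleR)
  have T: "?T \<in> sets borel"
    using assms by (intro infinite_element_borel)
  note [measurable] = polynomials_deg_le_borel[OF \<open>v \<in> polynomials_deg_le p\<close>] T \<open>F \<in> sets borel\<close>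
  have [measurable_cong]: "sets ?A = sets borel" by (simp add: affine_lborel_def Let_def)
  have g0: "?g x \<ge> 0" for x by (simp add: exp_weight_def)

  define \<beta> where "\<beta> = \<bar>n \<bullet> b\<bar> / (norm n * norm b)"
  have \<beta>: "\<bar>n \<bullet> b'\<bar> / norm n = \<beta>" by (simp add: \<beta>_def b'_def abs_mult)
  have "\<bar>n \<bullet> b\<bar> \<le> norm n * norm b" by (rule Cauchy_Schwarz_ineq2)
  then have "0 \<le> \<beta>" "\<beta> \<le> 1"
    using \<open>n \<noteq> 0\<close> \<open>b \<noteq> 0\<close> by (simp_all add: \<beta>_def)
  then have "sin (axis_angle n b) = \<beta>"
    by (simp add: axis_angle_def sin_arcsin flip: \<beta>_def)
  \<comment> \<open>At most \<beta> because the axis angle belongs to \<Theta>, and positive because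
    the sine is positive on (0, \<pi>).\<close>
  define \<mu> where "\<mu> = Min (sin ` \<Theta>)"
  have "\<mu> \<le> \<beta>"
    unfolding \<mu>_def \<open>sin (axis_angle n b) = \<beta>\<close>[symmetric]
    using \<open>finite \<Theta>\<close> \<open>axis_angle n b \<in> \<Theta>\<close> by (intro Min_le) auto
  have "\<mu> \<in> sin ` \<Theta>"
    unfolding \<mu>_def using \<open>finite \<Theta>\<close> \<open>axis_angle n b \<in> \<Theta>\<close> by (intro Min_in) auto
  then have "\<mu> > 0" using \<open>\<Theta> \<subseteq> {0<..<pi}\<close> sin_gt_zero by auto

  define h where "h = real p powr (1 / (2 * real k))"
  define M where "M = h + radius_of_base F"
  define X where "X = M ^ (2 * k) + 2 * real p + 6"
  \<comment> \<open>The least natural number with 2 m \<ge> D = M^(2k) / (2k), as the exponential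
    trace inequality requires.\<close>
  define m where "m = nat \<lceil>M ^ (2 * k) / (4 * real k)\<rceil>"
  have "h > 0" using \<open>p \<ge> 1\<close> by (simp add: h_def)
  have M: "norm s + h \<le> M" if "s \<in> F" for s
  proof -
    have "bdd_above (norm ` F)"
      using \<open>bounded F\<close> by (auto simp: bounded_iff bdd_above_def)
    then show ?thesis
      using that by (simp add: M_def radius_of_base_def cSUP_upper)
  qed
  have Mk: "0 \<le> M ^ (2 * k)" by (simp add: power_mult)
  have m: "M ^ (2 * k) / (2 * real k) \<le> 2 * real m"
    using real_nat_ceiling_ge[of "M ^ (2 * k) / (4 * real k)"] \<open>k \<ge> 1\<close> by (simp add: m_def field_simps)
  \<comment> \<open>Rounding up costs 1 and passing from degree N to N + 1 another 1; both fit into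
    the 3 contained in X / 2.\<close>
  have "real m \<le> M ^ (2 * k) / (4 * real k) + 1"
    using Mk by (simp add: m_def)
  also have "M ^ (2 * k) / (4 * real k) \<le> M ^ (2 * k) / 2"
    using Mk \<open>k \<ge> 1\<close> by (intro divide_left_mono) auto
  finally have "real (p + m) + 1 \<le> X / 2" by (simp add: X_def)
  then have Nm: "(real (p + m) + 1)\<^sup>2 \<le> X\<^sup>2 / 4"
    using power_mono[of "real (p + m) + 1" "X / 2" 2] by (simp add: power_divide)
  define C where "C = c_inv p k (radius_of_base F) \<Theta> * real p powr (2 - 1 / (2 * real k))"
  \<comment> \<open>The power of \<open>p\<close> in the claim divided by the p^2 in
    \<open>c_inv\<close> is 1 / h.\<close>
  have C: "C = X\<^sup>2 / (4 * h * \<mu>)"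
    using \<open>p \<ge> 1\<close> \<open>\<mu> > 0\<close> \<open>h > 0\<close>
    by (simp add: C_def c_inv_def powr_diff X_def M_def flip: h_def \<mu>_def)
  have "C \<ge> 0" using \<open>h > 0\<close> \<open>\<mu> > 0\<close> by (simp add: C)
  have "(real (p + m) + 1)\<^sup>2 / h \<le> X\<^sup>2 / (4 * h)"
    using Nm \<open>h > 0\<close> by (simp add: field_simps)
  also have "\<dots> = C * \<mu>" using \<open>\<mu> > 0\<close> by (simp add: C)
  also have "\<dots> \<le> C * \<beta>" using \<open>\<mu> \<le> \<beta>\<close> \<open>C \<ge> 0\<close> by (rule mult_left_mono)
  finally have const: "(real (p + m) + 1)\<^sup>2 / h \<le> C * \<beta>" .

  define f where "f x = ennreal (indicator ?T x * ?g x)" for x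
  have [measurable]: "f \<in> borel_measurable borel" unfolding f_def by measurable
  have "(\<integral>\<^sup>+s. ennreal (indicator F s * ?g s) \<partial>?A) \<le>
      (\<integral>\<^sup>+s. ennreal (C * \<beta>) * (\<integral>\<^sup>+t. f (s + t *\<^sub>R b') \<partial>lborel) \<partial>?A)"
  proof (rule nn_integral_mono)
    fix s
    show "ennreal (indicator F s * ?g s) \<le> ennreal (C * \<beta>) * (\<integral>\<^sup>+t. f (s + t *\<^sub>R b') \<partial>lborel)"
    proof (cases "s \<in> F")
      case True
      have "ennreal (?g s) \<le> ennreal ((real (p + m) + 1)\<^sup>2 / h) * (\<integral>\<^sup>+t. f (s + t *\<^sub>R b') \<partial>lborel)"
        unfolding f_def T'[symmetric]
        by (rule infinite_element_ray_ge[OF _ b' \<open>h > 0\<close> \<open>k \<ge> 1\<close> True M[OF True] m]) (use assms T T' in auto)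
      also have "\<dots> \<le> ennreal (C * \<beta>) * (\<integral>\<^sup>+t. f (s + t *\<^sub>R b') \<partial>lborel)"
        using const by (intro mult_right_mono ennreal_leI) auto
      finally show ?thesis using True by simp
    qed simp
  qed
  also have "\<dots> = ennreal (C * \<beta>) * (\<integral>\<^sup>+s. (\<integral>\<^sup>+t. f (s + t *\<^sub>R b') \<partial>lborel) \<partial>?A)"
    by (rule nn_integral_cmult) measurable
  \<comment> \<open>The Jacobian \<beta> is absorbed by slicing the volume integral along
    b'.\<close>
  also have "\<dots> = ennreal C * (\<integral>\<^sup>+x. f x \<partial>lborel)"
    using \<open>C \<ge> 0\<close> \<open>0 \<le> \<beta>\<close> nn_integral_lborel_hyperplane_slices[OF \<open>n \<noteq> 0\<close> nb', of f c]
    by (simp add: \<beta> ennreal_mult mult.assoc)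
  finally have le: "(\<integral>\<^sup>+s. ennreal (indicator F s * ?g s) \<partial>?A) \<le> ennreal C * (\<integral>\<^sup>+x. f x \<partial>lborel)" .

  have "(\<integral>\<^sup>+x. f x \<partial>lborel) \<le> (\<integral>\<^sup>+x. ennreal (?g x) \<partial>lborel)"
    using g0 by (intro nn_integral_mono) (auto simp: f_def indicator_def)
  also have "\<dots> < \<infinity>"
    by (rule nn_integral_polynomial_exp_weight_finite) fact+
  finally have fin: "(\<integral>\<^sup>+x. f x \<partial>lborel) < \<infinity>" .

  \<comment> \<open>Both integrands are nonnegative and measurable, so \<open>LINT\<close> is the
    real part of the nonnegative integral.\<close>
  have "(LINT s:F|?A. ?g s) = enn2real (\<integral>\<^sup>+s. ennreal (indicator F s * ?g s) \<partial>?A)"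
    unfolding set_lebesgue_integral_def real_scaleR_def
    using g0 by (intro integral_eq_nn_integral) (auto intro!: AE_I2)
  also have "\<dots> \<le> enn2real (ennreal C * (\<integral>\<^sup>+x. f x \<partial>lborel))"
    using le fin by (intro enn2real_mono) (simp_all add: ennreal_mult_less_top)
  also have "\<dots> = C * enn2real (\<integral>\<^sup>+x. f x \<partial>lborel)"
    using \<open>C \<ge> 0\<close> by (simp add: enn2real_mult)
  also have "enn2real (\<integral>\<^sup>+x. f x \<partial>lborel) = (LINT x:?T|lborel. ?g x)"
    unfolding set_lebesgue_integral_def real_scaleR_def f_def
    using g0 by (intro integral_eq_nn_integral[symmetric]) (auto intro!: AE_I2)
  finally show ?thesis unfolding C_def .
qed

end
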